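(* Let $M \ge N \ge 1$ be integers, let $x_0, \dots, x_{M-1}$ be i.i.d. random variables uniformly distributed on $[0,1)$, and let $\omega_0, \dots, \omega_{N-1} \in [-1/2, N-1/2)$ be given (deterministic) real numbers. Let $A \in \mathbb{C}^{M\times N}$ be the type-III NUDFT matrix, $A(j,k) = e^{2\pi i x_j \omega_k}$ for $0 \le j \le M-1$, $0 \le k \le N-1$. Given an integer $R \ge 2$, put $I_{N;R} = \{\ell \in \mathbb{Z} : -R \le \ell \le N-1+R\}$ and define $$B = \bigl(e^{2\pi i x_j \ell}\bigr)_{0\le j\le M-1,\ \ell \in I_{N;R}} \in \mathbb{C}^{M \times (N+2R)}, \qquad Q = (Q_{\ell,k})_{\ell \in I_{N;R},\ 0 \le k \le N-1} \in \mathbb{C}^{(N+2R)\times N},$$ where $Q_{\ell,k} = \int_0^1 e^{2\pi i (\omega_k - \ell)x}\,dx$. Let $E = A - BQ$ be the error matrix. Then $$\mathbb{E}\, E = 0 \qquad\text{and}\qquad \mathbb{E}\,\|E\|_F^2 \le \frac{2}{\pi^2 (R - 3/2)}\, \|A\|_F^2 .$$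
   Context: Here $i$ is the imaginary unit, $\|\cdot\|_F$ is the Frobenius norm, and $\mathbb{E}$ denotes expectation over the random points $x_0,\dots,x_{M-1}$ (entrywise for a matrix). Explicitly, $Q_{\ell,k} = e^{\pi i(\omega_k-\ell)} \frac{\sin(\pi(\omega_k-\ell))}{\pi(\omega_k-\ell)}$, with value $1$ when $\omega_k = \ell$; these are the Fourier coefficients of $x \mapsto e^{2\pi i \omega_k x}$ with respect to the orthonormal basis $\{e^{2\pi i \ell x}\}_{\ell\in\mathbb{Z}}$ of $L^2[0,1]$. Thus the entry $E(j,k)$ is the Fourier tail $\sum_{\ell \notin I_{N;R}} Q_{\ell,k} e^{2\pi i \ell x}$ (as an $L^2[0,1]$ function) evaluated at $x = x_j$, almost surely. Note that $\|A\|_F^2 = MN$ is deterministic, since all entries of $A$ have modulus one. *)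

theory Defs
  imports "HOL-Probability.Probability" "Jordan_Normal_Form.Matrix"
begin

definition frobenius_norm :: "complex mat \<Rightarrow> real" where
  "frobenius_norm A = sqrt (\<Sum>i<dim_row A. \<Sum>j<dim_col A. (cmod (A $$ (i, j)))\<^sup>2)"

definition mat_expectation :: "'w measure \<Rightarrow> nat \<Rightarrow> nat \<Rightarrow> ('w \<Rightarrow> complex mat) \<Rightarrow> complex mat" where
  "mat_expectation P m n X = Matrix.mat m n (\<lambda>(i, j). LINT w|P. X w $$ (i, j))"

definition nudft_mat :: "nat \<Rightarrow> nat \<Rightarrow> (nat \<Rightarrow> real) \<Rightarrow> (nat \<Rightarrow> real) \<Rightarrow> complex mat" where
  "nudft_mat M N x \<omega> =
     Matrix.mat M N (\<lambda>(j, k). exp (2 * of_real pi * \<i> * of_real (x j) * of_real (\<omega> k)))"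

text \<open>
  The index set \<open>I = {-R, ..., N - 1 + R}\<close> is enumerated increasingly: the position
  \<open>c < N + 2 * R\<close> stands for the frequency \<open>c - R\<close>.
\<close>

definition freq :: "nat \<Rightarrow> nat \<Rightarrow> int" where
  "freq R c = int c - int R"

lemma bij_betw_freq:
  "bij_betw (freq R) {..<N + 2 * R} {- int R..int N - 1 + int R}"
  by (rule bij_betwI[where g = "\<lambda>l. nat (l + int R)"]) (auto simp: freq_def)

definition fourier_mat :: "nat \<Rightarrow> nat \<Rightarrow> nat \<Rightarrow> (nat \<Rightarrow> real) \<Rightarrow> complex mat" where
  "fourier_mat M N R x =
     Matrix.mat M (N + 2 * R) (\<lambda>(j, c). exp (2 * of_real pi * \<i> * of_real (x j) * of_int (freq R c)))"

definition fourier_coeff :: "real \<Rightarrow> int \<Rightarrow> complex" where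
  "fourier_coeff w l =
     integral {0..1} (\<lambda>t::real. exp (2 * of_real pi * \<i> * of_real (w - of_int l) * of_real t))"

definition coeff_mat :: "nat \<Rightarrow> nat \<Rightarrow> (nat \<Rightarrow> real) \<Rightarrow> complex mat" where
  "coeff_mat N R \<omega> = Matrix.mat (N + 2 * R) N (\<lambda>(c, k). fourier_coeff (\<omega> k) (freq R c))"

definition error_mat :: "nat \<Rightarrow> nat \<Rightarrow> nat \<Rightarrow> (nat \<Rightarrow> real) \<Rightarrow> (nat \<Rightarrow> real) \<Rightarrow> complex mat" where
  "error_mat M N R x \<omega> = nudft_mat M N x \<omega> - fourier_mat M N R x * coeff_mat N R \<omega>"

text \<open>
  The Bochner integral of a non-integrable function is \<open>0\<close> by convention; the next two
  lemmas show that the expectations of the entries and of the squared Frobenius norm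
  of the error matrix are genuine.
\<close>

lemma error_mat_entry:
  assumes "j < M" "k < N"
  shows "error_mat M N R x \<omega> $$ (j, k) =
     exp (2 * of_real pi * \<i> * of_real (x j) * of_real (\<omega> k)) -
     (\<Sum>c<N + 2 * R. exp (2 * of_real pi * \<i> * of_real (x j) * of_int (freq R c)) *
        fourier_coeff (\<omega> k) (freq R c))"
  using assms
  by (simp add: error_mat_def nudft_mat_def fourier_mat_def coeff_mat_def scalar_prod_def
      lessThan_atLeast0)

lemma error_mat_entry_measurable:
  assumes "j < M" "k < N" "x j \<in> borel_measurable P"
  shows "(\<lambda>w. error_mat M N R (\<lambda>i. x i w) \<omega> $$ (j, k)) \<in> borel_measurable P"
  using assms(3) by (simp add: error_mat_entry[OF assms(1,2)])

lemma error_mat_entry_bound: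
  assumes "j < M" "k < N"
  shows "cmod (error_mat M N R x \<omega> $$ (j, k)) \<le>
    1 + (\<Sum>c<N + 2 * R. cmod (fourier_coeff (\<omega> k) (freq R c)))"
proof -
  have "cmod (exp (2 * of_real pi * \<i> * of_real a * of_real b)) = 1" for a b :: real
    by (simp add: norm_exp_eq_Re)
  moreover from this[of _ "of_int _"]
  have "cmod (exp (2 * of_real pi * \<i> * of_real a * of_int l)) = 1" for a :: real and l
    by simp
  ultimately show ?thesis
    unfolding error_mat_entry[OF assms]
    by (intro order.trans[OF norm_triangle_ineq4] add_mono order.trans[OF norm_sum] sum_mono)
       (simp_all add: norm_mult)
qed

lemma error_mat_entry_integrable:
  assumes "prob_space P" "j < M" "k < N" "x j \<in> borel_measurable P"
  shows "integrable P (\<lambda>w. error_mat M N R (\<lambda>i. x i w) \<omega> $$ (j, k))"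
proof -
  interpret prob_space P by fact
  show ?thesis
    using error_mat_entry_bound[OF assms(2,3)] error_mat_entry_measurable[where x = x, OF assms(2-4)]
    by (intro integrable_const_bound) auto
qed

lemma error_mat_frobenius_integrable:
  assumes "prob_space P" "\<And>j. j < M \<Longrightarrow> x j \<in> borel_measurable P"
  shows "integrable P (\<lambda>w. (frobenius_norm (error_mat M N R (\<lambda>i. x i w) \<omega>))\<^sup>2)"
proof -
  interpret prob_space P by fact
  have dims: "dim_row (error_mat M N R y \<omega>) = M" "dim_col (error_mat M N R y \<omega>) = N" for y
    by (simp_all add: error_mat_def fourier_mat_def coeff_mat_def)
  have "integrable P (\<lambda>w. (cmod (error_mat M N R (\<lambda>i. x i w) \<omega> $$ (j, k)))\<^sup>2)"
    if "j < M" "k < N" for j k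
    using power_mono[OF error_mat_entry_bound[OF that] norm_ge_zero, where n = 2]
      error_mat_entry_measurable[where x = x, OF that assms(2)[OF that(1)]]
    by (intro integrable_const_bound) auto
  then show ?thesis
    by (auto simp: frobenius_norm_def dims sum_nonneg intro!: Bochner_Integration.integrable_sum)
qed

end

theory Submission
  imports Defs
begin

text \<open>
  The expectation of \<open>exp (2 \<pi> i a x\<^sub>j)\<close> is \<open>Q\<close> at frequency difference \<open>a\<close>, so the exponentials of
  integer frequency are orthonormal and each entry of the error matrix is a Fourier tail, with mean
  \<open>0\<close> and second moment \<open>1 - \<Sum> |Q\<^sub>l|\<^sup>2\<close> over \<open>l \<in> I\<close>. As \<open>|Q\<^sub>l|\<^sup>2 = sin\<^sup>2 (\<pi> w) / (\<pi>\<^sup>2 (l - w)\<^sup>2)\<close>, the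
  inequality needed from Parseval's identity is \<open>1 / sin\<^sup>2 (\<pi> w) \<le> \<Sum> 1 / (\<pi>\<^sup>2 (l - w)\<^sup>2)\<close> over all
  integers \<open>l\<close>. It has an elementary proof: iterate
  \<open>1 / sin\<^sup>2 y = (1 / sin\<^sup>2 (y / 2) + 1 / sin\<^sup>2 ((y + \<pi>) / 2)) / 4\<close>, shift by an integer so that all
  \<open>2\<^sup>n\<close> resulting arguments lie in \<open>[-\<pi> / 2, \<pi> / 2]\<close>, and use \<open>1 / sin\<^sup>2 z \<le> 1 + 1 / z\<^sup>2\<close> there; the
  total error is \<open>2\<^sup>-\<^sup>n\<close>. The two tails of the series outside \<open>I\<close> are at most \<open>1 / R\<close> each by
  telescoping.
\<close>

section \<open>Elementary estimates for inverse squared sines and inverse squares\<close>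

lemma sin_eq_halves:
  fixes y :: real
  shows "sin y = 2 * sin (y / 2) * sin ((y + pi) / 2)"
  using sin_double[of "y / 2"] by (simp add: add_divide_distrib sin_add)

text \<open>Since \<open>sin ((y + pi) / 2)\<close> is \<open>cos (y / 2)\<close>, the two
  reciprocals add up to 1 over the product of the squares, and that product is a quarter of the
  squared sine of \<open>y\<close>.\<close>

lemma inverse_sin_squared_halves:
  fixes y :: real
  assumes "sin y \<noteq> 0"
  shows "1 / (sin y)\<^sup>2 = (1 / (sin (y / 2))\<^sup>2 + 1 / (sin ((y + pi) / 2))\<^sup>2) / 4"
proof -
  have "sin (y / 2) \<noteq> 0" "sin ((y + pi) / 2) \<noteq> 0"
    using assms sin_eq_halves[of y] by auto
  moreover have "(sin (y / 2))\<^sup>2 + (sin ((y + pi) / 2))\<^sup>2 = 1"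
    by (simp add: add_divide_distrib sin_add)
  ultimately show ?thesis
    unfolding sin_eq_halves[of y] by (simp add: field_simps)
qed

lemma sum_lessThan_double:
  fixes f :: "nat \<Rightarrow> 'a::comm_monoid_add"
  shows "(\<Sum>k<2 * m. f k) = (\<Sum>k<m. f (2 * k)) + (\<Sum>k<m. f (2 * k + 1))"
  by (induction m) (simp_all add: ac_simps)

text \<open>Induction for all \<open>y\<close> at once: the hypothesis at \<open>y / 2\<close> and
  at \<open>(y + pi) / 2\<close> supplies the even and the odd indices of the next level.\<close>

lemma inverse_sin_squared_dyadic:
  fixes y :: real
  assumes "sin y \<noteq> 0"
  shows "1 / (sin y)\<^sup>2 = (\<Sum>k<2 ^ n. 1 / (sin ((y + real k * pi) / 2 ^ n))\<^sup>2) / 4 ^ n"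
  using assms
proof (induction n arbitrary: y)
  case 0
  then show ?case by simp
next
  case (Suc n)
  have "sin (y / 2) \<noteq> 0" "sin ((y + pi) / 2) \<noteq> 0"
    using Suc.prems sin_eq_halves[of y] by auto
  note IH = this[THEN Suc.IH]
  have arg: "(y / 2 + real k * pi) / 2 ^ n = (y + real (2 * k) * pi) / 2 ^ Suc n"
    "((y + pi) / 2 + real k * pi) / 2 ^ n = (y + real (2 * k + 1) * pi) / 2 ^ Suc n" for k
    by (simp_all add: field_simps)
  show ?case
    unfolding inverse_sin_squared_halves[OF Suc.prems] IH arg
    by (simp only: power_Suc sum_lessThan_double add_divide_distrib) (simp add: field_simps)
qed

text \<open>The inverse squared sine is 1 plus the inverse squared tangent, and the tangent
  dominates its argument in absolute value. The endpoints are split off because the cosine vanishes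
  there.\<close>

lemma inverse_sin_squared_le:
  fixes x :: real
  assumes "x \<noteq> 0" "\<bar>x\<bar> \<le> pi / 2"
  shows "1 / (sin x)\<^sup>2 \<le> 1 + 1 / x\<^sup>2"
proof (cases "\<bar>x\<bar> = pi / 2")
  case True
  then have "x = pi / 2 \<or> x = - (pi / 2)" by linarith
  then have "(sin x)\<^sup>2 = 1"
    by (elim disjE ssubst) (simp_all only: sin_pi_half sin_minus power2_minus power_one)
  then show ?thesis by simp
next
  case False
  with assms have lt: "\<bar>x\<bar> < pi / 2" by simp
  then have c: "cos x > 0" by (intro cos_gt_zero_pi) auto
  have "sin x \<noteq> 0"
    using assms lt sin_zero_iff_int2[of x] sin_eq_0_pi[of x] by fastforce
  have "x\<^sup>2 \<le> (tan x)\<^sup>2"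
    using abs_tan_ge[OF lt] by (simp add: abs_le_square_iff)
  then have "1 / (tan x)\<^sup>2 \<le> 1 / x\<^sup>2"
    using assms(1) c \<open>sin x \<noteq> 0\<close> by (intro divide_left_mono) (auto simp: tan_def)
  moreover have "1 / (sin x)\<^sup>2 = 1 + 1 / (tan x)\<^sup>2"
    using \<open>sin x \<noteq> 0\<close> sin_cos_squared_add[of x] c by (simp add: tan_def field_simps)
  ultimately show ?thesis by simp
qed

text \<open>With \<open>t = l - w\<close>, the term is at most
  \<open>1 / (t - 1 / 2) - 1 / (t + 1 / 2)\<close>, which telescopes over consecutive
  \<open>l\<close>. The half steps leave a bound by the inverse distance from \<open>w\<close> to
  \<open>a - 1 / 2\<close>.\<close>

lemma sum_inverse_squares_tail_le:
  fixes S :: "int set" and w :: real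
  assumes "finite S" "\<And>l. l \<in> S \<Longrightarrow> a \<le> l" "w < of_int a - 1 / 2"
  shows "(\<Sum>l\<in>S. 1 / (of_int l - w)\<^sup>2) \<le> 1 / (of_int a - 1 / 2 - w)"
proof -
  define g :: "nat \<Rightarrow> real" where "g m = 1 / (of_int a - 1 / 2 - w + m)" for m
  have bnd: "1 / (of_int (a + int m) - w)\<^sup>2 \<le> g m - g (Suc m)" for m
  proof -
    define t :: real where "t = of_int a + m - w"
    have t: "t > 1 / 2" using assms(3) by (simp add: t_def)
    have "g m - g (Suc m) = 1 / (t - 1 / 2) - 1 / (t + 1 / 2)"
      by (simp add: g_def t_def algebra_simps)
    also have "\<dots> = 1 / (t\<^sup>2 - 1 / 4)"
      using t by (simp add: field_simps power2_eq_square)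
    also have "\<dots> \<ge> 1 / t\<^sup>2"
      using t power_strict_mono[of "1 / 2" t 2]
      by (intro divide_left_mono mult_pos_pos) (auto simp: power2_eq_square)
    finally show ?thesis by (simp add: t_def)
  qed
  \<comment> \<open>The finite set is enclosed in a run of \<open>n\<close> consecutive integers
    from \<open>a\<close>, so that a finite telescoping sum suffices. The empty set is separate
    because \<open>Max\<close> says nothing about it.\<close>
  obtain n where n: "\<And>l. l \<in> S \<Longrightarrow> l < a + int n"
  proof (cases "S = {}")
    case False
    have "l < a + int (nat (Max S - a + 1))" if "l \<in> S" for l
      using Max_ge[OF assms(1) that] assms(2)[OF that] by simp
    then show ?thesis using that by blast
  qed (use that in auto)
  have "S \<subseteq> (\<lambda>m. a + int m) ` {..<n}"
  proof
    fix l assume "l \<in> S"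
    with assms(2) n show "l \<in> (\<lambda>m. a + int m) ` {..<n}"
      by (intro image_eqI[of _ _ "nat (l - a)"]) force+
  qed
  then have "(\<Sum>l\<in>S. 1 / (of_int l - w)\<^sup>2) \<le> (\<Sum>l\<in>(\<lambda>m. a + int m) ` {..<n}. 1 / (of_int l - w)\<^sup>2)"
    by (intro sum_mono2) auto
  also have "\<dots> = (\<Sum>m<n. 1 / (of_int (a + int m) - w)\<^sup>2)"
    by (subst sum.reindex) (auto simp: inj_on_def)
  also have "\<dots> \<le> (\<Sum>m<n. g m - g (Suc m))"
    by (intro sum_mono bnd)
  also have "\<dots> = g 0 - g n"
    by (rule sum_lessThan_telescope')
  also have "\<dots> \<le> g 0"
    using assms(3) by (simp add: g_def)
  finally show ?thesis by (simp add: g_def)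
qed

section \<open>Fourier coefficients of exponentials on the unit interval\<close>

lemma integral_exp_eq:
  fixes a :: real
  assumes "a \<noteq> 0"
  shows "integral {0..1} (\<lambda>t::real. exp (2 * of_real pi * \<i> * of_real a * of_real t)) =
    (exp (\<i> * of_real (2 * pi * a)) - 1) / (\<i> * of_real (2 * pi * a))"
proof -
  define b where "b = \<i> * complex_of_real (2 * pi * a)"
  have b: "b \<noteq> 0" using assms by (simp add: b_def)
  have "((\<lambda>t::real. exp (b * of_real t)) has_integral
      exp (b * of_real 1) / b - exp (b * of_real 0) / b) {0..1}"
  proof (rule fundamental_theorem_of_calculus)
    fix t :: real
    have "((\<lambda>z. exp (b * z) / b) has_field_derivative exp (b * of_real t)) (at (of_real t))"
      using b by (auto intro!: derivative_eq_intros)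
    from has_vector_derivative_real_field[OF this]
    show "((\<lambda>t::real. exp (b * of_real t) / b) has_vector_derivative exp (b * of_real t)) (at t within {0..1})" .
  qed simp
  from integral_unique[OF this] show ?thesis
    by (simp add: b_def diff_divide_distrib mult_ac)
qed

lemma fourier_coeff_shift: "fourier_coeff w l = fourier_coeff (w - of_int l) 0"
  by (simp add: fourier_coeff_def)

text \<open>Orthonormality of the integer exponentials: off the diagonal the numerator
  \<open>exp (2 pi i (m - l)) - 1\<close> of the closed form vanishes.\<close>

lemma fourier_coeff_of_int: "fourier_coeff (of_int m) l = of_bool (m = l)"
proof (cases "m = l")
  case True
  then show ?thesis by (simp add: fourier_coeff_def)
next
  case False
  have "exp (\<i> * of_real (2 * pi * of_int (m - l))) = 1"
    by (subst exp_eq_1) (auto intro!: exI[of _ "m - l"])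
  then show ?thesis
    using False integral_exp_eq[of "of_int (m - l)"] by (simp add: fourier_coeff_def)
qed

lemma sin_squared_pi_shift: "(sin (pi * (w - of_int m)))\<^sup>2 = (sin (pi * w))\<^sup>2"
proof -
  have "sin (pi * of_int m) = 0"
    using sin_npi_int[of m] by (simp add: mult.commute)
  then show ?thesis
    using sin_cos_squared_add[of "pi * of_int m"]
    by (simp add: right_diff_distrib sin_diff power_mult_distrib)
qed

text \<open>The distance from \<open>exp (i t)\<close> to 1 is twice the absolute sine of
  \<open>t / 2\<close>. Shifting by an integer preserves the squared sine, so the numerator does not
  depend on \<open>l\<close>.\<close>

lemma norm_fourier_coeff_squared:
  assumes "w \<noteq> of_int l"
  shows "(cmod (fourier_coeff w l))\<^sup>2 = (sin (pi * w))\<^sup>2 / (pi\<^sup>2 * (of_int l - w)\<^sup>2)"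
proof -
  have s: "(sin (pi * (w - of_int l)))\<^sup>2 = (sin (pi * w))\<^sup>2"
    by (rule sin_squared_pi_shift)
  have "cmod (fourier_coeff w l) =
      cmod (exp (\<i> * of_real (2 * pi * (w - of_int l))) - 1) / cmod (\<i> * of_real (2 * pi * (w - of_int l)))"
    using assms integral_exp_eq[of "w - of_int l"] by (simp add: fourier_coeff_def norm_divide)
  also have "cmod (\<i> * of_real (2 * pi * (w - of_int l))) = 2 * (pi * \<bar>of_int l - w\<bar>)"
    unfolding norm_mult norm_of_real abs_mult abs_minus_commute[of w] by simp
  also have "cmod (exp (\<i> * of_real (2 * pi * (w - of_int l))) - 1) = 2 * \<bar>sin (pi * (w - of_int l))\<bar>"
    by (simp only: dist_exp_i_1) simp
  finally show ?thesis
    by (simp add: power_divide power_mult_distrib s)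
qed

lemma cnj_fourier_coeff: "cnj (fourier_coeff w 0) = fourier_coeff (- w) 0"
  by (simp add: fourier_coeff_def integral_cnj exp_cnj)

section \<open>Expectations under the uniform law\<close>

lemma integral_uniform_unit_interval:
  fixes f :: "real \<Rightarrow> 'b::euclidean_space"
  assumes "continuous_on UNIV f"
  shows "integral\<^sup>L (uniform_measure lborel {0..<1}) f = integral {0..1} f"
proof -
  have [measurable]: "f \<in> borel_measurable borel"
    using assms by (rule borel_measurable_continuous_onI)
  have "uniform_measure lborel {0..<1} = density lborel (\<lambda>t::real. ennreal (indicator {0..<1} t))"
    by (simp add: uniform_measure_def ennreal_indicator divide_ennreal_def)
  then have "integral\<^sup>L (uniform_measure lborel {0..<1}) f = (LINT t:{0..<1}|lborel. f t)"
    by (simp add: integral_density set_lebesgue_integral_def)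
  \<comment> \<open>Passage from the Bochner integral of the expectation to the gauge integral used
    in \<open>fourier_coeff\<close>.\<close>
  also have "\<dots> = integral {0..<1} f"
  proof (rule set_borel_integral_eq_integral)
    have "set_integrable lborel {0..1} f"
      by (rule borel_integrable_atLeastAtMost') (rule continuous_on_subset[OF assms], simp)
    then show "set_integrable lborel {0..<1} f"
      by (rule set_integrable_subset) auto
  qed
  also have "\<dots> = integral {0..1} f"
    by (rule integral_spike_set) (auto intro: negligible_subset[of "{1}"])
  finally show ?thesis .
qed

text \<open>The frequency \<open>a\<close> is an arbitrary real, so that the formula covers
  integers, \<open>\<omega> k\<close> and their differences, which are all the exponentials
  occurring in the first two moments.\<close>

lemma expectation_exp_uniform:
  fixes X :: "'w \<Rightarrow> real"
  assumes "X \<in> borel_measurable P" "distr P borel X = uniform_measure lborel {0..<1}"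
  shows "(LINT w|P. exp (2 * of_real pi * \<i> * of_real (X w) * of_real a)) = fourier_coeff a 0"
proof -
  have "(LINT w|P. exp (2 * of_real pi * \<i> * of_real (X w) * of_real a)) =
      (LINT t|distr P borel X. exp (2 * of_real pi * \<i> * of_real t * of_real a))"
    using assms(1) by (subst integral_distr) auto
  also have "\<dots> = fourier_coeff a 0"
    unfolding assms(2) fourier_coeff_def
    by (subst integral_uniform_unit_interval) (auto intro!: continuous_intros simp: mult_ac)
  finally show ?thesis .
qed

section \<open>Energy of the coefficients in a frequency window\<close>

lemma inverse_sin_squared_le_sum_window:
  fixes w :: real
  assumes "sin (pi * w) \<noteq> 0"
  obtains J :: "int set" where "finite J"
    "1 / (sin (pi * w))\<^sup>2 \<le> (\<Sum>l\<in>J. 1 / (of_int l - w)\<^sup>2) / pi\<^sup>2 + (1 / 2) ^ n"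
proof -
  \<comment> \<open>The integers \<open>L - k\<close> with \<open>k < 2 ^ n\<close> form a block
    around \<open>w\<close>, all within \<open>2 ^ n / 2\<close> of it; this places every
    \<open>z k\<close> in the range of \<open>inverse_sin_squared_le\<close>.\<close>
  define L where "L = \<lfloor>w + 2 ^ n / 2\<rfloor>"
  define z where "z k = (pi * (w - of_int L) + real k * pi) / 2 ^ n" for k
  have z_eq: "z k = pi * (w - of_int (L - int k)) / 2 ^ n" for k
    by (simp add: z_def algebra_simps)
  have four: "((2::real) ^ n)\<^sup>2 = 4 ^ n"
    by (simp add: power2_eq_square flip: power_mult_distrib)
  have nonint: "w \<noteq> of_int l" for l
    using assms sin_npi_int[of l] by (auto simp: mult.commute)
  have term_le: "1 / (sin (z k))\<^sup>2 / 4 ^ n \<le> 1 / 4 ^ n + 1 / (of_int (L - int k) - w)\<^sup>2 / pi\<^sup>2"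
    if "k < 2 ^ n" for k
  proof -
    \<comment> \<open>The integer form of \<open>k < 2 ^ n\<close> is essential: the gained 1
      absorbs the rounding error of the floor.\<close>
    have "real k \<le> 2 ^ n - 1"
      using that by (metis Suc_leI le_diff_eq of_nat_Suc of_nat_le_iff of_nat_numeral of_nat_power add.commute)
    then have "\<bar>w - of_int (L - int k)\<bar> \<le> 2 ^ n / 2"
      unfolding L_def abs_le_iff of_int_diff of_int_of_nat_eq
      using of_int_floor_le[of "w + 2 ^ n / 2"] floor_correct[of "w + 2 ^ n / 2"] by linarith
    then have "pi * \<bar>w - of_int (L - int k)\<bar> / 2 ^ n \<le> pi * (2 ^ n / 2) / 2 ^ n"
      by (intro divide_right_mono mult_left_mono) auto
    then have "\<bar>z k\<bar> \<le> pi / 2"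
      by (simp only: z_eq abs_divide abs_mult) simp
    moreover have "z k \<noteq> 0"
      using nonint[of "L - int k"] by (simp add: z_eq)
    ultimately have "1 / (sin (z k))\<^sup>2 \<le> 1 + 1 / (z k)\<^sup>2"
      by (intro inverse_sin_squared_le)
    also have "1 / (z k)\<^sup>2 = 4 ^ n * (1 / (of_int (L - int k) - w)\<^sup>2 / pi\<^sup>2)"
      by (simp add: z_eq power_divide power_mult_distrib four power2_commute[of w])
    finally show ?thesis
      by (simp add: field_simps)
  qed
  have "1 / (sin (pi * w))\<^sup>2 = 1 / (sin (pi * (w - of_int L)))\<^sup>2"
    by (simp only: sin_squared_pi_shift)
  also have "\<dots> = (\<Sum>k<2 ^ n. 1 / (sin (z k))\<^sup>2) / 4 ^ n"
    unfolding z_def using assms sin_squared_pi_shift[of w L]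
    by (intro inverse_sin_squared_dyadic) auto
  also have "\<dots> \<le> (\<Sum>k<2 ^ n. 1 / 4 ^ n + 1 / (of_int (L - int k) - w)\<^sup>2 / pi\<^sup>2)"
    unfolding sum_divide_distrib by (intro sum_mono term_le) auto
  also have "\<dots> = (1 / 2) ^ n + (\<Sum>k<2 ^ n. 1 / (of_int (L - int k) - w)\<^sup>2) / pi\<^sup>2"
    by (simp add: sum.distrib sum_divide_distrib power_divide flip: power_mult_distrib)
       (simp add: field_simps flip: power_mult_distrib)
  also have "(\<Sum>k<2 ^ n. 1 / (of_int (L - int k) - w)\<^sup>2) =
      (\<Sum>l\<in>(\<lambda>k. L - int k) ` {..<2 ^ n}. 1 / (of_int l - w)\<^sup>2)"
    by (subst sum.reindex) (auto simp: inj_on_def)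
  finally show ?thesis
    by (intro that[of "(\<lambda>k. L - int k) ` {..<2 ^ n}"]) auto
qed

text \<open>The margin \<open>r\<close> separates \<open>w\<close> from both
  \<open>a - 1 / 2\<close> and \<open>b + 1 / 2\<close>, so each outer tail of inverse squares is at
  most \<open>1 / r\<close>. An integer \<open>w\<close> is separate: its whole energy is the single
  coefficient at \<open>w\<close>, which lies in the window.\<close>

lemma fourier_coeff_energy_defect_le:
  fixes w :: real and a b :: int
  assumes "0 < r" "of_int a - 1 / 2 + r \<le> w" "w \<le> of_int b + 1 / 2 - r"
  shows "1 - (\<Sum>l\<in>{a..b}. (cmod (fourier_coeff w l))\<^sup>2) \<le> 2 / (pi\<^sup>2 * r)"
proof (cases "sin (pi * w) = 0")
  case True
  then obtain m where m: "w = of_int m"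
    by (auto simp: sin_zero_iff_int2)
  with assms have "m \<in> {a..b}" by auto
  then show ?thesis
    using assms(1) by (simp add: m fourier_coeff_of_int of_bool_def if_distrib[of cmod]
      if_distrib[of "\<lambda>x. x\<^sup>2"] cong: if_cong)
next
  case False
  define s where "s = (sin (pi * w))\<^sup>2"
  have s: "0 < s" "s \<le> 1"
    using False by (simp_all add: s_def abs_square_le_1)
  have nonint: "w \<noteq> of_int l" for l
    using False sin_npi_int[of l] by (auto simp: mult.commute)
  have ab: "a \<le> b"
    using assms by linarith
  let ?q = "\<lambda>l. 1 / (of_int l - w)\<^sup>2"
  have "1 \<le> (\<Sum>l\<in>{a..b}. (cmod (fourier_coeff w l))\<^sup>2) + 2 / (pi\<^sup>2 * r) + (1 / 2) ^ n" for n
  proof -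
    obtain J where J: "finite J" "1 / s \<le> (\<Sum>l\<in>J. ?q l) / pi\<^sup>2 + (1 / 2) ^ n"
      using inverse_sin_squared_le_sum_window[OF False, of n] unfolding s_def by blast
    have upper: "(\<Sum>l\<in>J \<inter> {b + 1..}. ?q l) \<le> 1 / r"
    proof -
      have "(\<Sum>l\<in>J \<inter> {b + 1..}. ?q l) \<le> 1 / (of_int (b + 1) - 1 / 2 - w)"
        using J(1) assms by (intro sum_inverse_squares_tail_le) auto
      also have "\<dots> \<le> 1 / r"
        using assms by (intro divide_left_mono) auto
      finally show ?thesis .
    qed
    have lower: "(\<Sum>l\<in>J \<inter> {..a - 1}. ?q l) \<le> 1 / r"
    proof -
      \<comment> \<open>Negating both \<open>l\<close> and \<open>w\<close> turns the left tail into
        a right tail starting at \<open>1 - a\<close>.\<close>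
      have "(\<Sum>l\<in>J \<inter> {..a - 1}. ?q l) = (\<Sum>l\<in>uminus ` (J \<inter> {..a - 1}). 1 / (of_int l - (- w))\<^sup>2)"
        by (subst sum.reindex) (auto simp: inj_on_def power2_commute[of w])
      also have "\<dots> \<le> 1 / (of_int (1 - a) - 1 / 2 - (- w))"
        using J(1) assms by (intro sum_inverse_squares_tail_le) auto
      also have "\<dots> \<le> 1 / r"
        using assms by (intro divide_left_mono) auto
      finally show ?thesis .
    qed
    \<comment> \<open>\<open>J\<close> may miss part of the window; adding all of
      \<open>{a..b}\<close> only increases the sum of nonnegative terms.\<close>
    have "J \<subseteq> {a..b} \<union> ((J \<inter> {..a - 1}) \<union> (J \<inter> {b + 1..}))" by auto
    then have "(\<Sum>l\<in>J. ?q l) \<le> (\<Sum>l\<in>{a..b} \<union> ((J \<inter> {..a - 1}) \<union> (J \<inter> {b + 1..})). ?q l)"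
      using J(1) by (intro sum_mono2) auto
    also have "\<dots> = (\<Sum>l\<in>{a..b}. ?q l) + (\<Sum>l\<in>(J \<inter> {..a - 1}) \<union> (J \<inter> {b + 1..}). ?q l)"
      using J(1) by (intro sum.union_disjoint) auto
    also have "(\<Sum>l\<in>(J \<inter> {..a - 1}) \<union> (J \<inter> {b + 1..}). ?q l) =
        ((\<Sum>l\<in>J \<inter> {..a - 1}. ?q l) + (\<Sum>l\<in>J \<inter> {b + 1..}. ?q l))"
      using J(1) ab by (intro sum.union_disjoint) auto
    finally have "(\<Sum>l\<in>J. ?q l) \<le> (\<Sum>l\<in>{a..b}. ?q l) + 2 / r"
      using upper lower by simp
    then have "(\<Sum>l\<in>J. ?q l) / pi\<^sup>2 \<le> ((\<Sum>l\<in>{a..b}. ?q l) + 2 / r) / pi\<^sup>2"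
      by (rule divide_right_mono) simp
    with J(2) have "1 / s \<le> ((\<Sum>l\<in>{a..b}. ?q l) + 2 / r) / pi\<^sup>2 + (1 / 2) ^ n"
      by linarith
    \<comment> \<open>Multiplication by \<open>s\<close> turns the inverse squares inside the window
      into squared coefficients; elsewhere \<open>s \<le> 1\<close> is enough.\<close>
    then have "s * (1 / s) \<le> s * (((\<Sum>l\<in>{a..b}. ?q l) + 2 / r) / pi\<^sup>2 + (1 / 2) ^ n)"
      using s by (intro mult_left_mono) auto
    also have "\<dots> = (\<Sum>l\<in>{a..b}. s * ?q l / pi\<^sup>2) + s * (2 / (pi\<^sup>2 * r)) + s * (1 / 2) ^ n"
      by (simp add: distrib_left add_divide_distrib sum_distrib_left sum_divide_distrib mult_ac)
    also have "(\<Sum>l\<in>{a..b}. s * ?q l / pi\<^sup>2) = (\<Sum>l\<in>{a..b}. (cmod (fourier_coeff w l))\<^sup>2)"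
      using nonint by (simp add: norm_fourier_coeff_squared s_def mult.commute)
    also have "s * (2 / (pi\<^sup>2 * r)) \<le> 2 / (pi\<^sup>2 * r)"
      using s assms(1) by (intro mult_left_le_one_le) auto
    also have "s * (1 / 2) ^ n \<le> (1 / 2) ^ n"
      using s by (intro mult_left_le_one_le) auto
    finally show ?thesis using s by simp
  qed
  \<comment> \<open>\<open>J\<close> varies with \<open>n\<close>, but the bound no longer mentions
    it, so the error \<open>(1 / 2) ^ n\<close> can be sent to 0.\<close>
  moreover have "(\<lambda>n. (\<Sum>l\<in>{a..b}. (cmod (fourier_coeff w l))\<^sup>2) + 2 / (pi\<^sup>2 * r) + (1 / 2) ^ n)
      \<longlonglongrightarrow> (\<Sum>l\<in>{a..b}. (cmod (fourier_coeff w l))\<^sup>2) + 2 / (pi\<^sup>2 * r) + 0"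
    by (intro tendsto_intros LIMSEQ_realpow_zero) auto
  ultimately have "1 \<le> (\<Sum>l\<in>{a..b}. (cmod (fourier_coeff w l))\<^sup>2) + 2 / (pi\<^sup>2 * r) + 0"
    by (intro LIMSEQ_le_const) auto
  then show ?thesis by simp
qed

section \<open>First and second moments of the entries of the error matrix\<close>

lemma error_mat_entry_expectation:
  assumes "prob_space P" "j < M" "k < N"
    and [measurable]: "x j \<in> borel_measurable P"
    and "distr P borel (x j) = uniform_measure lborel {0..<1}"
  shows "(LINT w|P. error_mat M N R (\<lambda>i. x i w) \<omega> $$ (j, k)) = 0"
proof -
  interpret prob_space P by fact
  let ?e = "\<lambda>a w. exp (2 * of_real pi * \<i> * of_real (x j w) * of_real a)"
  have e_integrable: "integrable P (?e a)" for a
    by (intro integrable_const_bound[where B = 1]) (auto simp: norm_exp_eq_Re)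
  have e_expectation: "(LINT w|P. ?e a w) = fourier_coeff a 0" for a
    by (intro expectation_exp_uniform assms)
  have "(LINT w|P. error_mat M N R (\<lambda>i. x i w) \<omega> $$ (j, k)) =
      (LINT w|P. ?e (\<omega> k) w -
        (\<Sum>c<N + 2 * R. ?e (of_int (freq R c)) w * fourier_coeff (\<omega> k) (freq R c)))"
    by (simp add: error_mat_entry[OF assms(2,3)])
  also have "\<dots> = (LINT w|P. ?e (\<omega> k) w) -
        (\<Sum>c<N + 2 * R. (LINT w|P. ?e (of_int (freq R c)) w) * fourier_coeff (\<omega> k) (freq R c))"
    using e_integrable by (subst Bochner_Integration.integral_diff)
      (auto intro!: Bochner_Integration.integrable_sum simp: Bochner_Integration.integral_sum simp del: of_real_of_int_eq)
  also have "\<dots> = fourier_coeff (\<omega> k) 0 -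
        (\<Sum>c<N + 2 * R. of_bool (freq R c = 0) * fourier_coeff (\<omega> k) (freq R c))"
    by (simp only: e_expectation fourier_coeff_of_int)
  also have "(\<Sum>c<N + 2 * R. of_bool (freq R c = 0) * fourier_coeff (\<omega> k) (freq R c)) =
      (\<Sum>l\<in>{- int R..int N - 1 + int R}. of_bool (l = 0) * fourier_coeff (\<omega> k) l)"
    by (rule sum.reindex_bij_betw[OF bij_betw_freq])
  \<comment> \<open>Frequency 0 belongs to the index range, where \<open>k < N\<close> gives
    \<open>N\<close> at least 1; its term cancels the mean of the exact exponential.\<close>
  also have "\<dots> = fourier_coeff (\<omega> k) 0"
    using assms(3) by (simp add: of_bool_def if_distrib[of "\<lambda>x. x * _"] cong: if_cong)
  finally show ?thesis by simp
qed

text \<open>Expanding the square gives \<open>1 - S - S + S\<close>, where \<open>S\<close> is the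
  energy in the window: each cross term has expectation \<open>S\<close>, and so has the double sum,
  by orthonormality.\<close>

lemma error_mat_entry_second_moment:
  assumes "prob_space P" "j < M" "k < N"
    and [measurable]: "x j \<in> borel_measurable P"
    and "distr P borel (x j) = uniform_measure lborel {0..<1}"
  shows "(LINT w|P. (cmod (error_mat M N R (\<lambda>i. x i w) \<omega> $$ (j, k)))\<^sup>2) =
    1 - (\<Sum>l\<in>{- int R..int N - 1 + int R}. (cmod (fourier_coeff (\<omega> k) l))\<^sup>2)"
proof -
  interpret prob_space P by fact
  let ?C = "{..<N + 2 * R}"
  define e where "e a w = exp (2 * of_real pi * \<i> * of_real (x j w) * of_real a)" for a w
  define q where "q c = fourier_coeff (\<omega> k) (freq R c)" for c
  define f where "f c = real_of_int (freq R c)" for c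
  have e_integrable [simp]: "integrable P (e a)" for a
    unfolding e_def by (intro integrable_const_bound[where B = 1]) (auto simp: norm_exp_eq_Re)
  have e_expectation: "(LINT w|P. e a w) = fourier_coeff a 0" for a
    unfolding e_def by (intro expectation_exp_uniform assms)
  have e_mult_cnj: "e a w * cnj (e b w) = e (a - b) w" for a b w
    by (simp add: e_def exp_cnj algebra_simps flip: exp_add)
  have q_expectation: "fourier_coeff (\<omega> k - f c) 0 = q c" "fourier_coeff (f c - \<omega> k) 0 = cnj (q c)" for c
    using fourier_coeff_shift[of "\<omega> k" "freq R c"] cnj_fourier_coeff[of "\<omega> k - f c"]
    by (simp_all add: q_def f_def)
  have ff_expectation: "fourier_coeff (f c - f d) 0 = of_bool (c = d)" for c d
    using fourier_coeff_of_int[of "freq R c - freq R d" 0] by (simp add: f_def freq_def)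
  have entry: "error_mat M N R (\<lambda>i. x i w) \<omega> $$ (j, k) = e (\<omega> k) w - (\<Sum>c\<in>?C. e (f c) w * q c)" for w
    by (simp add: error_mat_entry[OF assms(2,3)] e_def q_def f_def)
  \<comment> \<open>A product of one exponential with the conjugate of another is again an
    exponential, so the square becomes linear in exponentials of known expectation. The cast to the
    complex numbers is made because the cross terms need not be real individually.\<close>
  have square: "complex_of_real ((cmod (error_mat M N R (\<lambda>i. x i w) \<omega> $$ (j, k)))\<^sup>2) =
      e 0 w - (\<Sum>c\<in>?C. e (\<omega> k - f c) w * cnj (q c)) - (\<Sum>c\<in>?C. e (f c - \<omega> k) w * q c)
      + (\<Sum>c\<in>?C. \<Sum>d\<in>?C. e (f c - f d) w * (q c * cnj (q d)))" for w
  proof -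
    have "complex_of_real ((cmod (error_mat M N R (\<lambda>i. x i w) \<omega> $$ (j, k)))\<^sup>2) =
        e (\<omega> k) w * cnj (e (\<omega> k) w)
        - (\<Sum>c\<in>?C. (e (\<omega> k) w * cnj (e (f c) w)) * cnj (q c))
        - (\<Sum>c\<in>?C. (e (f c) w * cnj (e (\<omega> k) w)) * q c)
        + (\<Sum>c\<in>?C. \<Sum>d\<in>?C. (e (f c) w * cnj (e (f d) w)) * (q c * cnj (q d)))"
      unfolding entry complex_norm_square
      by (simp add: left_diff_distrib right_diff_distrib sum_product sum_distrib_left sum_distrib_right mult_ac, rule sum.swap)
    then show ?thesis by (simp only: e_mult_cnj) simp
  qed
  have "complex_of_real (LINT w|P. (cmod (error_mat M N R (\<lambda>i. x i w) \<omega> $$ (j, k)))\<^sup>2) =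
      (LINT w|P. e 0 w - (\<Sum>c\<in>?C. e (\<omega> k - f c) w * cnj (q c)) - (\<Sum>c\<in>?C. e (f c - \<omega> k) w * q c)
      + (\<Sum>c\<in>?C. \<Sum>d\<in>?C. e (f c - f d) w * (q c * cnj (q d))))"
    by (simp only: square flip: integral_complex_of_real)
  also have "\<dots> = fourier_coeff 0 0 - (\<Sum>c\<in>?C. q c * cnj (q c)) - (\<Sum>c\<in>?C. cnj (q c) * q c)
      + (\<Sum>c\<in>?C. \<Sum>d\<in>?C. of_bool (c = d) * (q c * cnj (q d)))"
    by (simp add: Bochner_Integration.integral_add Bochner_Integration.integral_diff
        Bochner_Integration.integral_sum e_expectation q_expectation ff_expectation
        Bochner_Integration.integrable_sum)
  also have "\<dots> = 1 - (\<Sum>c\<in>?C. q c * cnj (q c))"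
    using fourier_coeff_of_int[of 0 0]
    by (simp add: of_bool_def if_distrib[of "(*) _"] mult.commute cong: if_cong)
  also have "\<dots> = complex_of_real (1 - (\<Sum>c\<in>?C. (cmod (q c))\<^sup>2))"
    by (simp flip: complex_norm_square)
  also have "(\<Sum>c\<in>?C. (cmod (q c))\<^sup>2) =
      (\<Sum>l\<in>{- int R..int N - 1 + int R}. (cmod (fourier_coeff (\<omega> k) l))\<^sup>2)"
    unfolding q_def by (rule sum.reindex_bij_betw[OF bij_betw_freq])
  finally show ?thesis by (simp only: of_real_eq_iff)
qed

section \<open>Frobenius norms and the final estimate\<close>

lemma frobenius_norm_squared:
  "(frobenius_norm A)\<^sup>2 = (\<Sum>i<dim_row A. \<Sum>j<dim_col A. (cmod (A $$ (i, j)))\<^sup>2)"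
  by (simp add: frobenius_norm_def sum_nonneg)

lemma frobenius_norm_nudft_mat: "(frobenius_norm (nudft_mat M N y \<omega>))\<^sup>2 = real M * real N"
  by (simp add: frobenius_norm_squared nudft_mat_def norm_exp_eq_Re)

text \<open>All entries of \<open>A w\<close> have modulus one, so its squared norm is
  \<open>M * N\<close> at every \<open>w\<close>; the pointwise inequality therefore has a constant
  right-hand side, and a bound for each entry can be summed.\<close>

theorem proposition3p1:
  fixes P :: "'w measure"
    and M N R :: nat
    and x :: "nat \<Rightarrow> 'w \<Rightarrow> real"
    and \<omega> :: "nat \<Rightarrow> real"
    and A E :: "'w \<Rightarrow> complex mat"
  assumes "prob_space P"
    and "1 \<le> N" and "N \<le> M"
    and "prob_space.indep_vars P (\<lambda>_. borel) x {..<M}"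
    and "\<And>j. j < M \<Longrightarrow> distr P borel (x j) = uniform_measure lborel {0..<1}"
    and "\<And>k. k < N \<Longrightarrow> \<omega> k \<in> {- 1 / 2..<real N - 1 / 2}"
    and "2 \<le> R"
  defines "A \<equiv> \<lambda>w. nudft_mat M N (\<lambda>j. x j w) \<omega>"
    and "E \<equiv> \<lambda>w. error_mat M N R (\<lambda>j. x j w) \<omega>"
  shows "mat_expectation P M N E = 0\<^sub>m M N \<and>
    (\<forall>w\<in>space P. (LINT v|P. (frobenius_norm (E v))\<^sup>2)
      \<le> 2 / (pi\<^sup>2 * (real R - 3 / 2)) * (frobenius_norm (A w))\<^sup>2)"
proof (intro conjI ballI)
  interpret prob_space P by fact
  have x_measurable: "x j \<in> borel_measurable P" if "j < M" for j
    using assms(4) that by (simp add: indep_vars_def)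

  show "mat_expectation P M N E = 0\<^sub>m M N"
    by (rule eq_matI)
      (simp_all add: mat_expectation_def E_def error_mat_entry_expectation assms(1,5) x_measurable)
  fix w
  have entry_le: "(LINT v|P. (cmod (E v $$ (j, k)))\<^sup>2) \<le> 2 / (pi\<^sup>2 * (real R - 3 / 2))"
    if "j < M" "k < N" for j k
  proof -
    \<comment> \<open>The margin is \<open>r = R\<close>: the range of \<open>\<omega> k\<close>
      starts \<open>R\<close> above \<open>- R - 1 / 2\<close> and ends \<open>R\<close> below
      \<open>N - 1 + R + 1 / 2\<close>.\<close>
    have "(LINT v|P. (cmod (E v $$ (j, k)))\<^sup>2) \<le> 2 / (pi\<^sup>2 * real R)"
      unfolding E_def error_mat_entry_second_moment[where x = x, OF assms(1) that x_measurable[OF that(1)] assms(5)[OF that(1)]]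
      using assms(6)[OF that(2)] assms(7) by (intro fourier_coeff_energy_defect_le) auto
    also have "\<dots> \<le> 2 / (pi\<^sup>2 * (real R - 3 / 2))"
      using assms(7) by (intro divide_left_mono mult_left_mono mult_pos_pos) auto
    finally show ?thesis .
  qed
  have E_dim: "dim_row (E v) = M" "dim_col (E v) = N" for v
    by (simp_all add: E_def error_mat_def fourier_mat_def coeff_mat_def)
  have E_integrable: "integrable P (\<lambda>v. (cmod (E v $$ (j, k)))\<^sup>2)" if "j < M" "k < N" for j k
    unfolding E_def
    using power_mono[OF error_mat_entry_bound[OF that] norm_ge_zero, where n = 2]
      error_mat_entry_measurable[where x = x, OF that x_measurable[OF that(1)]]
    by (intro integrable_const_bound) auto
  have "(LINT v|P. (frobenius_norm (E v))\<^sup>2) = (LINT v|P. (\<Sum>j<M. \<Sum>k<N. (cmod (E v $$ (j, k)))\<^sup>2))"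
    by (simp add: frobenius_norm_squared E_dim)
  also have "\<dots> = (\<Sum>j<M. LINT v|P. (\<Sum>k<N. (cmod (E v $$ (j, k)))\<^sup>2))"
    by (intro Bochner_Integration.integral_sum Bochner_Integration.integrable_sum E_integrable) auto
  also have "\<dots> = (\<Sum>j<M. \<Sum>k<N. (LINT v|P. (cmod (E v $$ (j, k)))\<^sup>2))"
    by (intro sum.cong refl Bochner_Integration.integral_sum E_integrable) auto
  also have "\<dots> \<le> (\<Sum>j<M. \<Sum>k<N. 2 / (pi\<^sup>2 * (real R - 3 / 2)))"
    by (intro sum_mono entry_le) auto
  also have "\<dots> = 2 / (pi\<^sup>2 * (real R - 3 / 2)) * (frobenius_norm (A w))\<^sup>2"
    by (simp add: A_def frobenius_norm_nudft_mat)
  finally show "(LINT v|P. (frobenius_norm (E v))\<^sup>2)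
      \<le> 2 / (pi\<^sup>2 * (real R - 3 / 2)) * (frobenius_norm (A w))\<^sup>2" .
qed

end
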